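(* Let $S$ be a strong Garside family in an Ore category $\mathcal{C}$ that admits unique left-lcms. (i) The algorithm described in the context (double left-reversing) solves the Word Problem of $\mathcal{E}nv(\mathcal{C})$ with respect to $S$: running on a signed $S$-path $w$, it returns true if $w$ represents an identity element $1_x$ in $\mathcal{E}nv(\mathcal{C})$, and false otherwise. (ii) If $S$ is finite, the complexity of this algorithm is quadratic in the length of the input path.
   Context: Categories are viewed as monoids with a partial product: $fg$ is defined iff the target of $f$ is the source of $g$; $1_{\mathcal{C}}$ is the family of identity elements. An Ore category is a cancellative category in which any two elements with the same source have a common right-multiple and any two elements with the same target have a common left-multiple; it embeds in a groupoid of fractions $\mathcal{E}nv(\mathcal{C})$. $f\preccurlyeq g$ means $fg'=g$ for some $g'\in\mathcal{C}$. A left-lcm of $f,g$ is a common left-multiple $h$ such that every common left-multiple of $f,g$ is a left-multiple of $h$. "Admits unique left-lcms" means that any two elements with the same target have a unique left-lcm. $\mathcal{C}^\times$ is the family of invertible elements; $S^\sharp=S\mathcal{C}^\times\cup\mathcal{C}^\times$. A path $g_1|\cdots|g_p$ is $S$-normal if all entries lie in $S^\sharp$ and, for $i<p$, $a\in S$, $f\in\mathcal{C}$, $a\preccurlyeq fg_ig_{i+1}$ implies $a\preccurlyeq fg_i$; $S$ is a Garside family if every element of $\mathcal{C}$ is the product of an $S$-normal path. $f,g\in\mathcal{C}$ are left-disjoint if, for all $f',g'\in\mathcal{C}$ with $f^{-1}g=f'^{-1}g'$ in $\mathcal{E}nv(\mathcal{C})$, there is $h\in\mathcal{C}$ with $f'=hf$,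 $g'=hg$. A Garside family $S$ is strong if, for all $a,b\in S^\sharp$ with the same target, there are left-disjoint $a',b'\in S^\sharp$ with $a'b=b'a$. A signed $S$-path is a path whose entries are elements $a$ of $S$ or formal inverses $\overline a$ ($a\in S$, source and target exchanged); $\overline a$ represents $a^{-1}$ in $\mathcal{E}nv(\mathcal{C})$, and $\overline{w_1|w_2}=\overline{w_2}|\overline{w_1}$. Identity elements $1_x$ are identified with empty paths $\varepsilon_x$. Let $\widetilde\theta$ be the left-lcm selector on $S\cup1_{\mathcal{C}}$: for $a,b$ with the same target, $\widetilde\theta(a,b)b=\widetilde\theta(b,a)a$ is the left-lcm of $a,b$ (values lie in $S\cup1_{\mathcal{C}}$). Left-reversing a signed path means repeatedly replacing a subpath $b|\overline a$ with $\overline{\widetilde\theta(a,b)}|\widetilde\theta(b,a)$ (deleting it if $a=b$) until a negative–positive path is reached. Algorithm on input $w$: if the source and target of $w$ differ, return false. Left-reverse $w$ into a negative–positive path $\overline u|v$; left-reverse $v|\overline u$ into a negative–positive path $\overline{u'}|v'$; return true if $u'$ and $v'$ are both empty, false otherwise. Evaluations of $\widetilde\theta$ count as unit cost. *)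

theory Defs
  imports Main
begin

section \<open>Categories and divisibility\<close>

text \<open>
  Small categories, with composition written in diagrammatic order: \<open>f \<cdot>\<^bsub>C\<^esub> g\<close> is meaningful
  only if the target of \<open>f\<close> is the source of \<open>g\<close>.
\<close>

record ('o, 'm) cat =
  obj :: "'o set"
  arr :: "'m set"
  src :: "'m \<Rightarrow> 'o"
  tgt :: "'m \<Rightarrow> 'o"
  ident :: "'o \<Rightarrow> 'm"
  comp :: "'m \<Rightarrow> 'm \<Rightarrow> 'm"  (infixl "\<cdot>\<index>" 70)

locale category =
  fixes C :: "('o, 'm) cat" (structure)
  assumes src_obj: "f \<in> arr C \<Longrightarrow> src C f \<in> obj C"
    and tgt_obj: "f \<in> arr C \<Longrightarrow> tgt C f \<in> obj C"
    and ident_arr: "x \<in> obj C \<Longrightarrow> ident C x \<in> arr C"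
    and src_ident: "x \<in> obj C \<Longrightarrow> src C (ident C x) = x"
    and tgt_ident: "x \<in> obj C \<Longrightarrow> tgt C (ident C x) = x"
    and comp_arr: "\<lbrakk>f \<in> arr C; g \<in> arr C; tgt C f = src C g\<rbrakk> \<Longrightarrow> f \<cdot> g \<in> arr C"
    and src_comp: "\<lbrakk>f \<in> arr C; g \<in> arr C; tgt C f = src C g\<rbrakk> \<Longrightarrow> src C (f \<cdot> g) = src C f"
    and tgt_comp: "\<lbrakk>f \<in> arr C; g \<in> arr C; tgt C f = src C g\<rbrakk> \<Longrightarrow> tgt C (f \<cdot> g) = tgt C g"
    and comp_assoc: "\<lbrakk>f \<in> arr C; g \<in> arr C; h \<in> arr C; tgt C f = src C g; tgt C g = src C h\<rbrakk>
      \<Longrightarrow> (f \<cdot> g) \<cdot> h = f \<cdot> (g \<cdot> h)"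
    and ident_comp: "f \<in> arr C \<Longrightarrow> ident C (src C f) \<cdot> f = f"
    and comp_ident: "f \<in> arr C \<Longrightarrow> f \<cdot> ident C (tgt C f) = f"

definition identities :: "('o, 'm) cat \<Rightarrow> 'm set" where
  "identities C = ident C ` obj C"

definition is_inverse :: "('o, 'm) cat \<Rightarrow> 'm \<Rightarrow> 'm \<Rightarrow> bool" where
  "is_inverse C f g \<longleftrightarrow> f \<in> arr C \<and> g \<in> arr C \<and> src C g = tgt C f \<and> tgt C g = src C f \<and>
     f \<cdot>\<^bsub>C\<^esub> g = ident C (src C f) \<and> g \<cdot>\<^bsub>C\<^esub> f = ident C (tgt C f)"

definition invertibles :: "('o, 'm) cat \<Rightarrow> 'm set" where
  "invertibles C = {f. \<exists>g. is_inverse C f g}"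

definition inverse_arr :: "('o, 'm) cat \<Rightarrow> 'm \<Rightarrow> 'm" where
  "inverse_arr C f = (THE g. is_inverse C f g)"

definition left_divides :: "('o, 'm) cat \<Rightarrow> 'm \<Rightarrow> 'm \<Rightarrow> bool" where
  "left_divides C f g \<longleftrightarrow> f \<in> arr C \<and> (\<exists>g'\<in>arr C. tgt C f = src C g' \<and> f \<cdot>\<^bsub>C\<^esub> g' = g)"

definition left_multiple :: "('o, 'm) cat \<Rightarrow> 'm \<Rightarrow> 'm \<Rightarrow> bool" where
  "left_multiple C h f \<longleftrightarrow> f \<in> arr C \<and> (\<exists>f'\<in>arr C. tgt C f' = src C f \<and> f' \<cdot>\<^bsub>C\<^esub> f = h)"

definition cancellative :: "('o, 'm) cat \<Rightarrow> bool" where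
  "cancellative C \<longleftrightarrow>
     (\<forall>f\<in>arr C. \<forall>g\<in>arr C. \<forall>h\<in>arr C. tgt C f = src C g \<and> tgt C f = src C h \<and>
        f \<cdot>\<^bsub>C\<^esub> g = f \<cdot>\<^bsub>C\<^esub> h \<longrightarrow> g = h) \<and>
     (\<forall>f\<in>arr C. \<forall>g\<in>arr C. \<forall>h\<in>arr C. tgt C g = src C f \<and> tgt C h = src C f \<and>
        g \<cdot>\<^bsub>C\<^esub> f = h \<cdot>\<^bsub>C\<^esub> f \<longrightarrow> g = h)"

definition ore_category :: "('o, 'm) cat \<Rightarrow> bool" where
  "ore_category C \<longleftrightarrow> category C \<and> cancellative C \<and>
     (\<forall>f\<in>arr C. \<forall>g\<in>arr C. src C f = src C g \<longrightarrow> (\<exists>h. left_divides C f h \<and> left_divides C g h)) \<and>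
     (\<forall>f\<in>arr C. \<forall>g\<in>arr C. tgt C f = tgt C g \<longrightarrow> (\<exists>h. left_multiple C h f \<and> left_multiple C h g))"

definition is_left_lcm :: "('o, 'm) cat \<Rightarrow> 'm \<Rightarrow> 'm \<Rightarrow> 'm \<Rightarrow> bool" where
  "is_left_lcm C f g h \<longleftrightarrow> left_multiple C h f \<and> left_multiple C h g \<and>
     (\<forall>k. left_multiple C k f \<and> left_multiple C k g \<longrightarrow> left_multiple C k h)"

definition admits_unique_left_lcms :: "('o, 'm) cat \<Rightarrow> bool" where
  "admits_unique_left_lcms C \<longleftrightarrow>
     (\<forall>f\<in>arr C. \<forall>g\<in>arr C. tgt C f = tgt C g \<longrightarrow> (\<exists>!h. is_left_lcm C f g h))"


section \<open>Signed paths\<close>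

text \<open>\<open>Neg a\<close> stands for the formal inverse of \<open>a\<close>.\<close>

datatype 'm signed = Pos (unsigned: 'm) | Neg (unsigned: 'm)

fun lsrc :: "('o, 'm) cat \<Rightarrow> 'm signed \<Rightarrow> 'o" where
  "lsrc C (Pos a) = src C a"
| "lsrc C (Neg a) = tgt C a"

fun ltgt :: "('o, 'm) cat \<Rightarrow> 'm signed \<Rightarrow> 'o" where
  "ltgt C (Pos a) = tgt C a"
| "ltgt C (Neg a) = src C a"

text \<open>
  A signed path is stored together with its source, so that there is one empty path
  \<open>(x, [])\<close> for each object \<open>x\<close>.
\<close>

type_synonym ('o, 'm) spath = "'o \<times> 'm signed list"

abbreviation psrc :: "('o, 'm) spath \<Rightarrow> 'o" where
  "psrc p \<equiv> fst p"

definition ptgt :: "('o, 'm) cat \<Rightarrow> ('o, 'm) spath \<Rightarrow> 'o" where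
  "ptgt C p = (if snd p = [] then fst p else ltgt C (last (snd p)))"

abbreviation plength :: "('o, 'm) spath \<Rightarrow> nat" where
  "plength p \<equiv> length (snd p)"

fun is_path :: "('o, 'm) cat \<Rightarrow> 'o \<Rightarrow> 'm signed list \<Rightarrow> bool" where
  "is_path C x [] \<longleftrightarrow> x \<in> obj C"
| "is_path C x (l # ls) \<longleftrightarrow> unsigned l \<in> arr C \<and> lsrc C l = x \<and> is_path C (ltgt C l) ls"

definition signed_paths :: "('o, 'm) cat \<Rightarrow> 'm set \<Rightarrow> ('o, 'm) spath set" where
  "signed_paths C A = {(x, ls). is_path C x ls \<and> unsigned ` set ls \<subseteq> A}"


section \<open>The groupoid of fractions\<close>

text \<open>
  The enveloping groupoid is the one presented by the arrows of \<open>C\<close> and their formal inverses,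
  subject to the relations of \<open>C\<close> and to the relations making \<open>Neg f\<close> inverse to \<open>Pos f\<close>.
  Its elements are the classes of signed \<open>C\<close>-paths.
\<close>

inductive env_step :: "('o, 'm) cat \<Rightarrow> ('o, 'm) spath \<Rightarrow> ('o, 'm) spath \<Rightarrow> bool" for C where
  comp: "is_path C x (us @ [Pos f, Pos g] @ vs) \<Longrightarrow>
    env_step C (x, us @ [Pos f, Pos g] @ vs) (x, us @ [Pos (f \<cdot>\<^bsub>C\<^esub> g)] @ vs)"
| ident: "is_path C x (us @ [Pos (ident C y)] @ vs) \<Longrightarrow> y \<in> obj C \<Longrightarrow>
    env_step C (x, us @ [Pos (ident C y)] @ vs) (x, us @ vs)"
| pos_neg: "is_path C x (us @ [Pos f, Neg f] @ vs) \<Longrightarrow>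
    env_step C (x, us @ [Pos f, Neg f] @ vs) (x, us @ vs)"
| neg_pos: "is_path C x (us @ [Neg f, Pos f] @ vs) \<Longrightarrow>
    env_step C (x, us @ [Neg f, Pos f] @ vs) (x, us @ vs)"

definition env_cong :: "('o, 'm) cat \<Rightarrow> (('o, 'm) spath \<times> ('o, 'm) spath) set" where
  "env_cong C = {(p, q). p \<in> signed_paths C (arr C) \<and> q \<in> signed_paths C (arr C) \<and>
     equivclp (env_step C) p q}"

text \<open>The element of the enveloping groupoid that a signed path represents:\<close>

definition env_class :: "('o, 'm) cat \<Rightarrow> ('o, 'm) spath \<Rightarrow> ('o, 'm) spath set" where
  "env_class C p = env_cong C `` {p}"

definition Env :: "('o, 'm) cat \<Rightarrow> ('o, ('o, 'm) spath set) cat" where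
  "Env C = \<lparr>
     obj = obj C,
     arr = signed_paths C (arr C) // env_cong C,
     src = (\<lambda>X. the_elem (psrc ` X)),
     tgt = (\<lambda>X. the_elem (ptgt C ` X)),
     ident = (\<lambda>x. env_class C (x, [])),
     comp = (\<lambda>X Y. \<Union>p\<in>X. \<Union>q\<in>Y. env_class C (psrc p, snd p @ snd q)) \<rparr>"

definition to_Env :: "('o, 'm) cat \<Rightarrow> 'm \<Rightarrow> ('o, 'm) spath set" where
  "to_Env C f = env_class C (src C f, [Pos f])"

text \<open>The left fraction of numerator \<open>g\<close> and denominator \<open>f\<close>, for \<open>f\<close>, \<open>g\<close> with the same source:\<close>

definition left_fraction :: "('o, 'm) cat \<Rightarrow> 'm \<Rightarrow> 'm \<Rightarrow> ('o, 'm) spath set" where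
  "left_fraction C f g = inverse_arr (Env C) (to_Env C f) \<cdot>\<^bsub>Env C\<^esub> to_Env C g"

definition left_disjoint :: "('o, 'm) cat \<Rightarrow> 'm \<Rightarrow> 'm \<Rightarrow> bool" where
  "left_disjoint C f g \<longleftrightarrow> f \<in> arr C \<and> g \<in> arr C \<and> src C f = src C g \<and>
     (\<forall>f'\<in>arr C. \<forall>g'\<in>arr C. src C f' = src C g' \<and> left_fraction C f g = left_fraction C f' g' \<longrightarrow>
        (\<exists>h\<in>arr C. tgt C h = src C f \<and> f' = h \<cdot>\<^bsub>C\<^esub> f \<and> g' = h \<cdot>\<^bsub>C\<^esub> g))"


section \<open>Garside families\<close>

definition sharp :: "('o, 'm) cat \<Rightarrow> 'm set \<Rightarrow> 'm set" where
  "sharp C S = {s \<cdot>\<^bsub>C\<^esub> e |s e. s \<in> S \<and> e \<in> invertibles C \<and> tgt C s = src C e} \<union> invertibles C"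

definition normal_path :: "('o, 'm) cat \<Rightarrow> 'm set \<Rightarrow> 'o \<Rightarrow> 'm list \<Rightarrow> bool" where
  "normal_path C S x gs \<longleftrightarrow> is_path C x (map Pos gs) \<and> set gs \<subseteq> sharp C S \<and>
     (\<forall>i. Suc i < length gs \<longrightarrow> (\<forall>a\<in>S. \<forall>f\<in>arr C. tgt C f = src C (gs ! i) \<longrightarrow>
        left_divides C a (f \<cdot>\<^bsub>C\<^esub> gs ! i \<cdot>\<^bsub>C\<^esub> gs ! Suc i) \<longrightarrow> left_divides C a (f \<cdot>\<^bsub>C\<^esub> gs ! i)))"

fun path_prod :: "('o, 'm) cat \<Rightarrow> 'o \<Rightarrow> 'm list \<Rightarrow> 'm" where
  "path_prod C x [] = ident C x"
| "path_prod C x (g # gs) = g \<cdot>\<^bsub>C\<^esub> path_prod C (tgt C g) gs"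

definition garside_family :: "('o, 'm) cat \<Rightarrow> 'm set \<Rightarrow> bool" where
  "garside_family C S \<longleftrightarrow> S \<subseteq> arr C \<and>
     (\<forall>g\<in>arr C. \<exists>gs. normal_path C S (src C g) gs \<and> path_prod C (src C g) gs = g)"

definition strong_garside_family :: "('o, 'm) cat \<Rightarrow> 'm set \<Rightarrow> bool" where
  "strong_garside_family C S \<longleftrightarrow> garside_family C S \<and>
     (\<forall>a\<in>sharp C S. \<forall>b\<in>sharp C S. tgt C a = tgt C b \<longrightarrow>
        (\<exists>a'\<in>sharp C S. \<exists>b'\<in>sharp C S. tgt C a' = src C b \<and> tgt C b' = src C a \<and>
           left_disjoint C a' b' \<and> a' \<cdot>\<^bsub>C\<^esub> b = b' \<cdot>\<^bsub>C\<^esub> a))"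


section \<open>Double left-reversing\<close>

text \<open>
  The left-lcm selector: the \<open>c\<close> such that \<open>c \<cdot> b\<close> is the left-lcm of \<open>a\<close> and \<open>b\<close>.
\<close>

definition lcm_selector :: "('o, 'm) cat \<Rightarrow> 'm \<Rightarrow> 'm \<Rightarrow> 'm" where
  "lcm_selector C a b =
     (THE c. c \<in> arr C \<and> tgt C c = src C b \<and> is_left_lcm C a b (c \<cdot>\<^bsub>C\<^esub> b))"

text \<open>
  Identity elements are identified with empty paths. Paths are represented in the reversing
  process with all entries that are identities removed.
\<close>

definition erase :: "('o, 'm) cat \<Rightarrow> 'm signed list \<Rightarrow> 'm signed list" where
  "erase C ls = filter (\<lambda>l. unsigned l \<notin> identities C) ls"

inductive left_rev :: "('o, 'm) cat \<Rightarrow> ('o, 'm) spath \<Rightarrow> ('o, 'm) spath \<Rightarrow> bool" for C where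
  "left_rev C (x, us @ [Pos b, Neg a] @ vs)
     (x, us @ (if a = b then []
               else erase C [Neg (lcm_selector C a b), Pos (lcm_selector C b a)]) @ vs)"

text \<open>
  The negative path formally inverse to the positive path \<open>u\<close>:
\<close>

definition neg_path :: "'m list \<Rightarrow> 'm signed list" where
  "neg_path u = map Neg (rev u)"

definition pos_path :: "'m list \<Rightarrow> 'm signed list" where
  "pos_path u = map Pos u"

text \<open>
  The algorithm as a transition system. It is non-deterministic, because the next subpath to be
  replaced may be chosen freely. \<open>Rev1\<close> and \<open>Rev2\<close> are the first and the second
  left-reversing. The second argument of \<open>alg_step\<close> is the cost of the transition: a
  replacement, which takes two evaluations of the left-lcm selector and a local change in
  the path, has unit cost, and a pass through a path costs its length (plus one). With the path as
  a doubly linked list and a list of pointers to the subpaths that can be replaced,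
  finding a subpath to replace takes constant time.
\<close>

datatype ('o, 'm) state =
  Start "('o, 'm) spath" | Rev1 "('o, 'm) spath" | Rev2 "('o, 'm) spath" | Return bool

inductive alg_step :: "('o, 'm) cat \<Rightarrow> ('o, 'm) state \<Rightarrow> nat \<Rightarrow> ('o, 'm) state \<Rightarrow> bool" for C where
  reject: "psrc w \<noteq> ptgt C w \<Longrightarrow> alg_step C (Start w) (Suc (plength w)) (Return False)"
| start: "psrc w = ptgt C w \<Longrightarrow>
    alg_step C (Start w) (Suc (plength w)) (Rev1 (psrc w, erase C (snd w)))"
| rev1: "left_rev C p q \<Longrightarrow> alg_step C (Rev1 p) 1 (Rev1 q)"
| swap: "alg_step C (Rev1 (x, neg_path u @ pos_path v)) (Suc (length u + length v))
    (Rev2 (ptgt C (x, neg_path u), pos_path v @ neg_path u))"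
| rev2: "left_rev C p q \<Longrightarrow> alg_step C (Rev2 p) 1 (Rev2 q)"
| answer: "alg_step C (Rev2 (y, neg_path u @ pos_path v)) (Suc (length u + length v))
    (Return (u = [] \<and> v = []))"

inductive alg_run :: "('o, 'm) cat \<Rightarrow> ('o, 'm) state \<Rightarrow> nat \<Rightarrow> ('o, 'm) state \<Rightarrow> bool" for C where
  refl: "alg_run C s 0 s"
| step: "alg_run C s m t \<Longrightarrow> alg_step C t n t' \<Longrightarrow> alg_run C s (m + n) t'"

text \<open>Whatever the choices, the algorithm stops on input \<open>w\<close>, and it then has returned \<open>b\<close>:\<close>

definition alg_returns :: "('o, 'm) cat \<Rightarrow> ('o, 'm) spath \<Rightarrow> bool \<Rightarrow> bool" where
  "alg_returns C w b \<longleftrightarrow>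
     \<not> (\<exists>s. s 0 = Start w \<and> (\<forall>i. \<exists>n. alg_step C (s i) n (s (Suc i)))) \<and>
     (\<forall>m t. alg_run C (Start w) m t \<and> \<not> (\<exists>n t'. alg_step C t n t') \<longrightarrow> t = Return b)"

definition represents_identity :: "('o, 'm) cat \<Rightarrow> ('o, 'm) spath \<Rightarrow> bool" where
  "represents_identity C w \<longleftrightarrow> (\<exists>x\<in>obj C. env_class C w = ident (Env C) x)"

end

theory Submission
  imports Defs
begin

text \<open>
  A signed path acts on the arrows that end at its source: a letter \<open>Pos a\<close> multiplies by \<open>a\<close> on
  the right, and a letter \<open>Neg a\<close> divides by \<open>a\<close> on the right, which is possible for left-multiples
  of \<open>a\<close> only and has at most one result by cancellativity. \<open>carries C f ls g\<close> says that \<open>ls\<close> sends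
  \<open>f\<close> to \<open>g\<close> in this way; then \<open>ls\<close> represents \<open>f\<inverse>g\<close> in the groupoid of fractions. Correctness of
  the algorithm comes from four properties of this partial action.

  Reversing does not change it (\<open>left_rev_step\<close>). Indeed \<open>b|a\<inverse>\<close> sends \<open>f\<close> to \<open>h\<close> if and only if
  \<open>f b = h a\<close>. Such an element is a left-multiple \<open>k a' b = k b' a\<close> of the left-lcm
  \<open>a' b = b' a\<close>, so that \<open>f = k a'\<close> and \<open>h = k b'\<close> by cancellation; this says that \<open>a'\<inverse>|b'\<close> sends
  \<open>f\<close> to \<open>h\<close>.

  A path represents an identity if and only if it is closed and fixes some arrow
  (\<open>represents_identity_iff\<close>). One direction is a computation in the groupoid. For the other one,
  applying a relation of the groupoid can enlarge or shrink the domain of the action but does not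
  change its values where both sides are defined. Each domain is closed under left-multiplication,
  so that, since common left-multiples exist, no domain is empty and any two of them meet. This
  argument contains the embedding theorem of Ore.

  A closed path \<open>u\<inverse>|v\<close> fixes some arrow if and only if \<open>u\<close> and \<open>v\<close> have the same product, hence if
  and only if the exchanged path \<open>v|u\<inverse>\<close> fixes the identity (\<open>fixes_some_iff_swap_fixes_ident\<close>).

  Finally, uniqueness of left-lcms leaves no invertible elements but the identities. A path
  \<open>u'\<inverse>|v'\<close> without identity entries can therefore fix the identity only if it is empty
  (\<open>neg_pos_fixes_ident_iff\<close>): the second reversing decides the equality left open by the first.

  As for the cost, a replacement turns a positive letter followed by a negative one into at most one
  negative letter followed by at most one positive letter. Thus the length does not increase, and
  the number of pairs of a positive letter and a later negative one decreases. At the start of each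
  reversing, this number is at most the square of the length of the input.
\<close>

section \<open>Arrows of a cancellative category with unique left-lcms\<close>

locale lcm_category = category C for C :: "('o, 'm) cat" (structure) +
  assumes cancellative: "cancellative C"
    and unique_left_lcms: "admits_unique_left_lcms C"
begin

lemma left_cancel:
  "\<lbrakk>f \<cdot> g = f \<cdot> h; f \<in> arr C; g \<in> arr C; h \<in> arr C; tgt C f = src C g; tgt C f = src C h\<rbrakk> \<Longrightarrow> g = h"
  using cancellative unfolding cancellative_def by blast

lemma right_cancel:
  "\<lbrakk>g \<cdot> f = h \<cdot> f; f \<in> arr C; g \<in> arr C; h \<in> arr C; tgt C g = src C f; tgt C h = src C f\<rbrakk> \<Longrightarrow> g = h"
  using cancellative unfolding cancellative_def by blast

lemma ex_left_lcm:
  assumes "a \<in> arr C" "b \<in> arr C" "tgt C a = tgt C b"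
  obtains h where "is_left_lcm C a b h"
  using assms unique_left_lcms unfolding admits_unique_left_lcms_def by blast

lemma left_lcm_unique:
  assumes "is_left_lcm C a b h" "is_left_lcm C a b k"
    and "a \<in> arr C" "b \<in> arr C" "tgt C a = tgt C b"
  shows "h = k"
  using assms unique_left_lcms unfolding admits_unique_left_lcms_def by blast

lemma common_left_multiple:
  assumes "a \<in> arr C" "b \<in> arr C" "tgt C a = tgt C b"
  obtains k l where "k \<in> arr C" "l \<in> arr C" "tgt C k = src C a" "tgt C l = src C b" "k \<cdot> a = l \<cdot> b"
  using ex_left_lcm[OF assms] unfolding is_left_lcm_def left_multiple_def by metis

lemma is_left_lcm_commute: "is_left_lcm C a b h \<longleftrightarrow> is_left_lcm C b a h"
  unfolding is_left_lcm_def by blast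

lemma lcm_selector:
  assumes "a \<in> arr C" "b \<in> arr C" "tgt C a = tgt C b"
  shows "lcm_selector C a b \<in> arr C" "tgt C (lcm_selector C a b) = src C b"
    "is_left_lcm C a b (lcm_selector C a b \<cdot> b)"
proof -
  let ?P = "\<lambda>c. c \<in> arr C \<and> tgt C c = src C b \<and> is_left_lcm C a b (c \<cdot> b)"
  obtain h where h: "is_left_lcm C a b h" using ex_left_lcm[OF assms] .
  then obtain c where c: "c \<in> arr C" "tgt C c = src C b" "c \<cdot> b = h"
    unfolding is_left_lcm_def left_multiple_def by blast
  have "?P c" using c h by simp
  moreover have "d = c" if "?P d" for d
    using that c h left_lcm_unique[OF _ _ assms] right_cancel assms by metis
  ultimately have "?P (lcm_selector C a b)"
    unfolding lcm_selector_def by (rule theI)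
  then show "lcm_selector C a b \<in> arr C" "tgt C (lcm_selector C a b) = src C b"
    "is_left_lcm C a b (lcm_selector C a b \<cdot> b)" by auto
qed

lemma lcm_selector_commute:
  assumes "a \<in> arr C" "b \<in> arr C" "tgt C a = tgt C b"
  shows "lcm_selector C a b \<cdot> b = lcm_selector C b a \<cdot> a"
  using assms lcm_selector left_lcm_unique is_left_lcm_commute by metis

lemma src_lcm_selector:
  assumes "a \<in> arr C" "b \<in> arr C" "tgt C a = tgt C b"
  shows "src C (lcm_selector C a b) = src C (lcm_selector C b a)"
  using assms lcm_selector lcm_selector_commute src_comp by metis

text \<open>
  By cancellation \<open>g f\<close> is an identity too. Thus \<open>f\<close> is invertible, and its left-multiples are all
  the arrows with the same target. They are also the left-multiples of the identity at this target, and both \<open>f\<close> and this identity are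
  left-lcms of the identity with itself.
\<close>

lemma factor_of_identity:
  assumes "f \<in> arr C" "g \<in> arr C" "tgt C f = src C g" "f \<cdot> g \<in> identities C"
  shows "f \<in> identities C" "g \<in> identities C"
proof -
  obtain x where x: "x \<in> obj C" "f \<cdot> g = ident C x" using assms(4) unfolding identities_def by auto
  have sf: "src C f = x" and tg: "tgt C g = x"
    using assms x src_comp[of f g] tgt_comp[of f g] by (simp_all add: src_ident tgt_ident)
  let ?y = "tgt C f"
  have y: "?y \<in> obj C" using assms tgt_obj by blast
  have "f \<cdot> (g \<cdot> f) = f \<cdot> ident C ?y"
    using assms x sf tg comp_assoc[of f g f] ident_comp[of f] comp_ident[of f] by simp
  then have gf: "g \<cdot> f = ident C ?y"
    using assms sf tg y left_cancel comp_arr src_comp ident_arr src_ident by metis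
  let ?i = "ident C ?y"
  have i: "?i \<in> arr C" "src C ?i = ?y" "tgt C ?i = ?y"
    using y ident_arr src_ident tgt_ident by auto
  have mult: "left_multiple C k ?i \<longleftrightarrow> k \<in> arr C \<and> tgt C k = ?y" for k
    unfolding left_multiple_def using i comp_ident by (metis (no_types))
  have "left_multiple C k f" if "k \<in> arr C" "tgt C k = ?y" for k
  proof -
    have "(k \<cdot> g) \<cdot> f = k"
      using that assms sf tg comp_assoc[of k g f] gf comp_ident[of k] by simp
    then show ?thesis
      unfolding left_multiple_def using that assms sf tg comp_arr[of k g] tgt_comp[of k g] by auto
  qed
  then have "is_left_lcm C ?i ?i f" unfolding is_left_lcm_def mult using assms by auto
  moreover have "is_left_lcm C ?i ?i ?i" unfolding is_left_lcm_def mult using i by auto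
  ultimately have f: "f = ?i" using left_lcm_unique i by metis
  then show "f \<in> identities C" using y unfolding identities_def by auto
  have "f \<cdot> g = g" using f assms ident_comp by metis
  then show "g \<in> identities C" using assms by simp
qed

end

section \<open>The action of signed paths on arrows\<close>

fun carries :: "('o, 'm) cat \<Rightarrow> 'm \<Rightarrow> 'm signed list \<Rightarrow> 'm \<Rightarrow> bool" where
  "carries C f [] g \<longleftrightarrow> f = g"
| "carries C f (Pos a # ls) g \<longleftrightarrow> carries C (f \<cdot>\<^bsub>C\<^esub> a) ls g"
| "carries C f (Neg a # ls) g \<longleftrightarrow>
     (\<exists>h\<in>arr C. tgt C h = src C a \<and> f = h \<cdot>\<^bsub>C\<^esub> a \<and> carries C h ls g)"

lemma ptgt_Nil [simp]: "ptgt C (x, []) = x"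
  by (simp add: ptgt_def)

lemma ptgt_Cons [simp]: "ptgt C (x, l # ls) = ptgt C (ltgt C l, ls)"
  by (simp add: ptgt_def)

lemma ptgt_append [simp]: "ptgt C (x, us @ vs) = ptgt C (ptgt C (x, us), vs)"
  by (induction us arbitrary: x) auto

lemma is_path_arr: "is_path C x ls \<Longrightarrow> unsigned ` set ls \<subseteq> arr C"
  by (induction ls arbitrary: x) auto

lemma carries_append:
  "carries C f (us @ vs) g \<longleftrightarrow> (\<exists>h. carries C f us h \<and> carries C h vs g)"
  by (induction C f us g rule: carries.induct) auto

context category
begin

lemma is_path_obj: "is_path C x ls \<Longrightarrow> x \<in> obj C"
  by (cases ls; cases "hd ls") (auto simp: src_obj tgt_obj)

lemma is_path_append:
  "is_path C x (us @ vs) \<longleftrightarrow> is_path C x us \<and> is_path C (ptgt C (x, us)) vs"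
  by (induction us arbitrary: x) (auto dest: is_path_obj)

lemma carries_arr:
  assumes "carries C f ls g" "f \<in> arr C" "is_path C (tgt C f) ls"
  shows "g \<in> arr C" "src C g = src C f" "tgt C g = ptgt C (tgt C f, ls)"
proof -
  have "g \<in> arr C \<and> src C g = src C f \<and> tgt C g = ptgt C (tgt C f, ls)"
    using assms
  proof (induction ls arbitrary: f)
    case (Cons l ls)
    show ?case
    proof (cases l)
      case (Pos a)
      then show ?thesis
        using Cons.IH[of "f \<cdot> a"] Cons.prems comp_arr[of f a] src_comp[of f a] tgt_comp[of f a]
        by simp
    next
      case (Neg a)
      then obtain h where "h \<in> arr C" "tgt C h = src C a" "f = h \<cdot> a" "carries C h ls g"
        using Cons.prems by auto
      then show ?thesis
        using Neg Cons.IH[of h] Cons.prems src_comp[of h a] by simp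
    qed
  qed simp
  then show "g \<in> arr C" "src C g = src C f" "tgt C g = ptgt C (tgt C f, ls)" by auto
qed

lemma carries_scale:
  assumes "carries C f ls g" "f \<in> arr C" "is_path C (tgt C f) ls" "k \<in> arr C" "tgt C k = src C f"
  shows "carries C (k \<cdot> f) ls (k \<cdot> g)"
  using assms
proof (induction ls arbitrary: f)
  case (Cons l ls)
  show ?case
  proof (cases l)
    case (Pos a)
    then show ?thesis
      using Cons.IH[of "f \<cdot> a"] Cons.prems
        comp_arr[of f a] src_comp[of f a] tgt_comp[of f a] comp_assoc[of k f a]
      by simp
  next
    case (Neg a)
    then obtain h where h: "h \<in> arr C" "tgt C h = src C a" "f = h \<cdot> a" "carries C h ls g"
      using Cons.prems by auto
    then have "carries C (k \<cdot> h) ls (k \<cdot> g)" "tgt C k = src C h"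
      using Neg Cons.IH[of h] Cons.prems src_comp[of h a] by simp_all
    moreover from this have "k \<cdot> h \<in> arr C" "tgt C (k \<cdot> h) = src C a" "k \<cdot> f = (k \<cdot> h) \<cdot> a"
      using h Neg Cons.prems comp_arr[of k h] tgt_comp[of k h] comp_assoc[of k h a] by simp_all
    ultimately show ?thesis using Neg by auto
  qed
qed simp

text \<open>
  Both the reversing and the relations of the groupoid act on a factor of a path, and the properties
  of the action are checked on that factor.
\<close>

lemma carries_replace:
  assumes "carries C f (us @ ls @ vs) g" "f \<in> arr C" "is_path C (tgt C f) (us @ ls @ vs)"
    and "\<And>h k. \<lbrakk>h \<in> arr C; tgt C h = ptgt C (tgt C f, us); carries C h ls k\<rbrakk> \<Longrightarrow> carries C h ms k"
  shows "carries C f (us @ ms @ vs) g"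
  using assms carries_arr[of f us] unfolding carries_append is_path_append by metis

lemma is_path_replace:
  assumes "is_path C x (us @ ls @ vs)" "is_path C (ptgt C (x, us)) ms"
    and "ptgt C (ptgt C (x, us), ms) = ptgt C (ptgt C (x, us), ls)"
  shows "is_path C x (us @ ms @ vs)" "ptgt C (x, us @ ms @ vs) = ptgt C (x, us @ ls @ vs)"
  using assms by (simp_all add: is_path_append)

lemma is_path_erase:
  assumes "is_path C x ls"
  shows "is_path C x (erase C ls)" "ptgt C (x, erase C ls) = ptgt C (x, ls)"
proof -
  have "is_path C x (erase C ls) \<and> ptgt C (x, erase C ls) = ptgt C (x, ls)"
    using assms
  proof (induction ls arbitrary: x)
    case (Cons l ls)
    have "lsrc C l = ltgt C l" if "unsigned l \<in> identities C"
      using that by (cases l) (auto simp: identities_def src_ident tgt_ident)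
    then show ?case using Cons by (auto simp: erase_def)
  qed (simp add: erase_def)
  then show "is_path C x (erase C ls)" "ptgt C (x, erase C ls) = ptgt C (x, ls)" by auto
qed

lemma carries_erase:
  assumes "f \<in> arr C" "is_path C (tgt C f) ls"
  shows "carries C f (erase C ls) g \<longleftrightarrow> carries C f ls g"
  using assms
proof (induction ls arbitrary: f)
  case (Cons l ls)
  have tail_iff: "carries C h (erase C ls) g \<longleftrightarrow> carries C h ls g"
    if "h \<in> arr C" "tgt C h = ltgt C l" for h
    using Cons that by simp
  show ?case
  proof (cases "unsigned l \<in> identities C")
    case True
    then obtain y where y: "y \<in> obj C" "unsigned l = ident C y" unfolding identities_def by auto
    then have ty: "tgt C f = y" "ltgt C l = y"
      using Cons.prems by (cases l; simp add: src_ident tgt_ident)+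
    have "carries C f (l # ls) g \<longleftrightarrow> carries C f ls g"
    proof (cases l)
      case (Pos a)
      then show ?thesis using y ty Cons.prems comp_ident[of f] by simp
    next
      case (Neg a)
      have "f = h \<cdot> ident C y \<longleftrightarrow> f = h" if "h \<in> arr C" "tgt C h = y" for h
        using that comp_ident by metis
      then show ?thesis using Neg y ty Cons.prems by (auto simp: src_ident)
    qed
    then show ?thesis using True tail_iff[of f] ty Cons.prems by (simp add: erase_def)
  next
    case False
    then have e: "erase C (l # ls) = l # erase C ls" by (simp add: erase_def)
    show ?thesis
    proof (cases l)
      case (Pos a)
      then show ?thesis
        unfolding e using tail_iff[of "f \<cdot> a"] Cons.prems comp_arr[of f a] tgt_comp[of f a] by simp
    next
      case (Neg a)
      then show ?thesis unfolding e using tail_iff by (auto simp: Neg)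
    qed
  qed
qed (simp add: erase_def)

lemma is_path_neg_path_iff:
  "is_path C x (neg_path u) \<and> ptgt C (x, neg_path u) = z \<longleftrightarrow>
   is_path C z (pos_path u) \<and> ptgt C (z, pos_path u) = x"
proof (induction u arbitrary: z)
  case (Cons a u)
  have "is_path C x (neg_path (a # u)) \<and> ptgt C (x, neg_path (a # u)) = z \<longleftrightarrow>
    a \<in> arr C \<and> src C a = z \<and> is_path C x (neg_path u) \<and> ptgt C (x, neg_path u) = tgt C a"
    by (auto simp: neg_path_def is_path_append src_obj)
  also have "\<dots> \<longleftrightarrow> is_path C z (pos_path (a # u)) \<and> ptgt C (z, pos_path (a # u)) = x"
    using Cons[of "tgt C a"] by (auto simp: pos_path_def)
  finally show ?case .
qed (auto simp: neg_path_def pos_path_def)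

lemma carries_neg_path_iff:
  assumes "f \<in> arr C" "h \<in> arr C"
    and "is_path C (tgt C h) (pos_path u)" "ptgt C (tgt C h, pos_path u) = tgt C f"
  shows "carries C f (neg_path u) h \<longleftrightarrow> carries C h (pos_path u) f"
  using assms
proof (induction u arbitrary: h)
  case (Cons a u)
  have "carries C f (neg_path (a # u)) h \<longleftrightarrow> carries C f (neg_path u) (h \<cdot> a)"
    using Cons.prems by (auto simp: neg_path_def carries_append pos_path_def)
  also have "\<dots> \<longleftrightarrow> carries C (h \<cdot> a) (pos_path u) f"
    using Cons.prems Cons.IH[of "h \<cdot> a"] comp_arr[of h a] tgt_comp[of h a]
    by (simp add: pos_path_def)
  finally show ?case by (simp add: pos_path_def)
qed (auto simp: neg_path_def pos_path_def)

lemma carries_pos_path_total: "\<exists>g. carries C f (pos_path u) g"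
proof (induction u arbitrary: f)
  case (Cons a u)
  then show ?case using Cons[of "f \<cdot> a"] by (simp add: pos_path_def)
next
  case Nil
  have "carries C f (pos_path []) f" by (simp add: pos_path_def)
  then show ?case by blast
qed

end

context lcm_category
begin

lemma carries_unique:
  assumes "carries C f ls g" "carries C f ls g'" "f \<in> arr C" "is_path C (tgt C f) ls"
  shows "g = g'"
  using assms
proof (induction ls arbitrary: f)
  case (Cons l ls)
  show ?case
  proof (cases l)
    case (Pos a)
    then show ?thesis
      using Cons.IH[of "f \<cdot> a"] Cons.prems comp_arr[of f a] tgt_comp[of f a] by simp
  next
    case (Neg a)
    then obtain h h' where h: "h \<in> arr C" "tgt C h = src C a" "f = h \<cdot> a" "carries C h ls g"
      "h' \<in> arr C" "tgt C h' = src C a" "f = h' \<cdot> a" "carries C h' ls g'"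
      using Cons.prems by auto
    then have "h = h'" using right_cancel[of h a h'] Neg Cons.prems by simp
    then show ?thesis using Cons.IH[of h] h Neg Cons.prems by simp
  qed
qed simp

text \<open>
  An arrow on which the path is defined is found by going backwards: a negative letter is undone by
  a multiplication, and before a positive letter a common left-multiple is needed.
\<close>

lemma carries_domain_nonempty:
  assumes "is_path C x ls"
  shows "\<exists>f\<in>arr C. tgt C f = x \<and> (\<exists>g. carries C f ls g)"
  using assms
proof (induction ls arbitrary: x)
  case Nil
  then show ?case using ident_arr tgt_ident by auto
next
  case (Cons l ls)
  then obtain f g where f: "f \<in> arr C" "tgt C f = ltgt C l" "carries C f ls g"
    using Cons.IH[of "ltgt C l"] Cons.prems unfolding is_path.simps by blast
  show ?case
  proof (cases l)
    case (Pos a)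
    then have a: "a \<in> arr C" "src C a = x" "tgt C f = tgt C a" using f Cons.prems by auto
    obtain k m where km: "k \<in> arr C" "m \<in> arr C" "tgt C k = src C f" "tgt C m = src C a"
      "k \<cdot> f = m \<cdot> a" using common_left_multiple[OF f(1) a(1,3)] .
    then have "carries C (m \<cdot> a) ls (k \<cdot> g)"
      using carries_scale[OF f(3,1), of k] f Cons.prems by simp
    then show ?thesis using Pos km a by auto
  next
    case (Neg a)
    then have "f \<cdot> a \<in> arr C" "tgt C (f \<cdot> a) = x" "carries C (f \<cdot> a) (l # ls) g"
      using f Cons.prems comp_arr[of f a] tgt_comp[of f a] by auto
    then show ?thesis by blast
  qed
qed

section \<open>Reversing preserves the action\<close>

text \<open>
  Both sides say that \<open>f b = h a\<close>: the right-hand side by definition, the left-hand side because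
  every common left-multiple of \<open>a\<close> and \<open>b\<close> factors through their left-lcm.
\<close>

lemma carries_tile:
  assumes a: "a \<in> arr C" "b \<in> arr C" "tgt C a = tgt C b"
    and f: "f \<in> arr C" "tgt C f = src C b"
  shows "carries C f [Neg (lcm_selector C a b), Pos (lcm_selector C b a)] h \<longleftrightarrow>
    carries C f [Pos b, Neg a] h"
proof -
  let ?a' = "lcm_selector C a b" and ?b' = "lcm_selector C b a"
  have a': "?a' \<in> arr C" "tgt C ?a' = src C b" "is_left_lcm C a b (?a' \<cdot> b)"
    using lcm_selector[OF a] by auto
  have b': "?b' \<in> arr C" "tgt C ?b' = src C a" using lcm_selector a by auto
  note eq = lcm_selector_commute[OF a] src_lcm_selector[OF a]
  have "(\<exists>k\<in>arr C. tgt C k = src C ?a' \<and> f = k \<cdot> ?a' \<and> k \<cdot> ?b' = h) \<longleftrightarrow>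
    h \<in> arr C \<and> tgt C h = src C a \<and> f \<cdot> b = h \<cdot> a" (is "?L \<longleftrightarrow> ?R")
  proof
    assume ?L
    then obtain k where k: "k \<in> arr C" "tgt C k = src C ?a'" "f = k \<cdot> ?a'" "k \<cdot> ?b' = h" by blast
    then show ?R
      using a a' b' eq comp_assoc[of k ?a' b] comp_assoc[of k ?b' a] comp_arr[of k ?b']
        tgt_comp[of k ?b'] by simp
  next
    assume R: ?R
    then have "left_multiple C (f \<cdot> b) a" "left_multiple C (f \<cdot> b) b"
      unfolding left_multiple_def using a f by (metis, metis)
    then have "left_multiple C (f \<cdot> b) (?a' \<cdot> b)" using a'(3) unfolding is_left_lcm_def by blast
    then obtain k where k: "k \<in> arr C" "tgt C k = src C ?a'" "k \<cdot> (?a' \<cdot> b) = f \<cdot> b"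
      unfolding left_multiple_def using a a' src_comp by metis
    have "(k \<cdot> ?a') \<cdot> b = f \<cdot> b" using k a a' comp_assoc by simp
    then have f': "f = k \<cdot> ?a'"
      using right_cancel[of "k \<cdot> ?a'" b f] k a a' f comp_arr[of k ?a'] tgt_comp[of k ?a'] by simp
    have "(k \<cdot> ?b') \<cdot> a = h \<cdot> a" using k a b' eq R comp_assoc[of k ?b' a] by simp
    then have "k \<cdot> ?b' = h"
      using right_cancel[of "k \<cdot> ?b'" a h] k a b' eq R comp_arr[of k ?b'] tgt_comp[of k ?b'] by simp
    then show ?L using k f' by blast
  qed
  then show ?thesis by auto
qed

lemma left_rev_step:
  assumes "left_rev C (x, ls) (y, ms)" "is_path C x ls"
  shows "y = x" "is_path C x ms" "ptgt C (x, ms) = ptgt C (x, ls)"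
    and "erase C ls = ls \<Longrightarrow> erase C ms = ms"
    and "\<lbrakk>f \<in> arr C; tgt C f = x\<rbrakk> \<Longrightarrow> carries C f ms g \<longleftrightarrow> carries C f ls g"
proof -
  obtain us a b vs where ls: "ls = us @ [Pos b, Neg a] @ vs" and y: "y = x"
    and ms: "ms = us @ (if a = b then []
      else erase C [Neg (lcm_selector C a b), Pos (lcm_selector C b a)]) @ vs"
    using assms(1) by (cases rule: left_rev.cases) auto
  let ?m = "if a = b then [] else erase C [Neg (lcm_selector C a b), Pos (lcm_selector C b a)]"
  let ?z = "ptgt C (x, us)"
  show "y = x" by (fact y)
  have ab: "a \<in> arr C" "b \<in> arr C" "tgt C a = tgt C b" "src C b = ?z"
    using assms(2) ls by (auto simp: is_path_append)
  have tile: "is_path C ?z [Neg (lcm_selector C a b), Pos (lcm_selector C b a)]"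
    using ab lcm_selector[of a b] lcm_selector[of b a] src_lcm_selector[of a b] src_obj by simp
  have m: "is_path C ?z ?m \<and> ptgt C (?z, ?m) = src C a"
    using tile is_path_erase[OF tile] ab lcm_selector[of b a] src_obj[of b] by auto
  then show "is_path C x ms" "ptgt C (x, ms) = ptgt C (x, ls)"
    using is_path_replace[of x us "[Pos b, Neg a]" vs ?m] assms(2) ls ms by simp_all
  show "erase C ms = ms" if "erase C ls = ls"
  proof -
    have "unsigned l \<notin> identities C" if "l \<in> set us \<union> set vs" for l
      using that \<open>erase C ls = ls\<close> unfolding ls erase_def filter_id_conv by auto
    then show ?thesis unfolding ms erase_def filter_id_conv by auto
  qed
  show "carries C f ms g \<longleftrightarrow> carries C f ls g" if f: "f \<in> arr C" "tgt C f = x"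
  proof -
    have m_iff: "carries C h ?m k \<longleftrightarrow> carries C h [Pos b, Neg a] k"
      if h: "h \<in> arr C" "tgt C h = ?z" for h k
    proof (cases "a = b")
      case True
      then have "h \<cdot> b = k \<cdot> a \<longleftrightarrow> h = k" if "k \<in> arr C" "tgt C k = src C a" for k
        using that h ab right_cancel[of h a k] by auto
      then show ?thesis using True h ab by auto
    next
      case False
      then show ?thesis using carries_tile[of a b h k] carries_erase[of h] tile ab h by simp
    qed
    then show ?thesis
      using carries_replace[of f us "[Pos b, Neg a]" vs g ?m]
        carries_replace[of f us ?m vs g "[Pos b, Neg a]"]
        f assms(2) \<open>is_path C x ms\<close> ls ms by auto
  qed
qed

section \<open>Paths representing an identity\<close>

lemma env_step_path:
  assumes "env_step C p q"
  shows "is_path C (psrc p) (snd p)" "is_path C (psrc q) (snd q)"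
    "psrc q = psrc p" "ptgt C q = ptgt C p"
  using assms
  by (cases rule: env_step.cases;
      force simp: is_path_append comp_arr src_comp tgt_comp src_ident tgt_ident)+

lemma env_step_carries:
  assumes "env_step C p q" "f \<in> arr C" "tgt C f = psrc p" "carries C f (snd p) g"
  shows "carries C f (snd q) g"
  using assms(1)
proof (cases rule: env_step.cases)
  case (comp x us a b vs)
  then show ?thesis
    using carries_replace[of f us "[Pos a, Pos b]" vs g "[Pos (a \<cdot> b)]"] assms
    by (auto simp: is_path_append comp_assoc)
next
  case (ident x us y vs)
  then show ?thesis
    using carries_replace[of f us "[Pos (ident C y)]" vs g "[]"] assms
    by (auto simp: is_path_append src_ident) (metis comp_ident)
next
  case (pos_neg x us a vs)
  then have a: "a \<in> arr C" "src C a = ptgt C (tgt C f, us)" using assms by (auto simp: is_path_append)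
  then have "carries C h [] k"
    if "h \<in> arr C" "tgt C h = ptgt C (tgt C f, us)" "carries C h [Pos a, Neg a] k" for h k
    using that right_cancel[of h a k] by auto
  then show ?thesis
    using pos_neg carries_replace[of f us "[Pos a, Neg a]" vs g "[]"] assms by auto
next
  case (neg_pos x us a vs)
  have "carries C f (us @ [] @ vs) g"
    by (rule carries_replace[of f us "[Neg a, Pos a]"]) (use neg_pos assms in auto)
  then show ?thesis using neg_pos by simp
qed

text \<open>
  A relation can also be applied from right to left, and then it may fail to act on \<open>f\<close>: the path
  \<open>q\<close> of the step from \<open>p\<close> to \<open>q\<close> may be defined on more arrows than \<open>p\<close>. In this case \<open>f\<close> is
  replaced by one of its left-multiples on which \<open>p\<close> is defined.
\<close>

lemma equiv_empty_fixes_some: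
  assumes "equivclp (env_step C) (x, []) w" "x \<in> obj C"
  shows "psrc w = x \<and> is_path C x (snd w) \<and> ptgt C w = x \<and>
    (\<exists>f\<in>arr C. tgt C f = x \<and> carries C f (snd w) f)"
  using assms(1)
proof (induction rule: equivclp_induct)
  case base
  then show ?case using assms(2) ident_arr tgt_ident by auto
next
  case (step q p)
  then obtain f where q: "psrc q = x" "is_path C x (snd q)" "ptgt C q = x"
    and f: "f \<in> arr C" "tgt C f = x" "carries C f (snd q) f" by blast
  from step(2) show ?case
  proof
    assume "env_step C q p"
    then show ?thesis using q f env_step_path env_step_carries by metis
  next
    assume pq: "env_step C p q"
    note p = env_step_path[OF pq]
    obtain f' g where f': "f' \<in> arr C" "tgt C f' = x" "carries C f' (snd p) g"
      using carries_domain_nonempty[OF p(1)] p q by auto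
    obtain k l where kl: "k \<in> arr C" "l \<in> arr C" "tgt C k = src C f" "tgt C l = src C f'"
      "k \<cdot> f = l \<cdot> f'"
      using common_left_multiple[OF f(1) f'(1)] f f' by auto
    let ?m = "l \<cdot> f'"
    have m: "?m \<in> arr C" "tgt C ?m = x" using kl f' comp_arr tgt_comp by auto
    have cp: "carries C ?m (snd p) (l \<cdot> g)" using carries_scale[OF f'(3,1)] f' kl p q by simp
    then have "carries C ?m (snd q) (l \<cdot> g)" using env_step_carries[OF pq] m p q by simp
    moreover have "carries C ?m (snd q) ?m" using carries_scale[OF f(3,1)] f kl q by metis
    ultimately have "l \<cdot> g = ?m" using carries_unique m q by metis
    then show ?thesis using cp m p q by auto
  qed
qed

text \<open>
  In the groupoid, \<open>f\<close> swallows the letters of the path one by one. A letter \<open>Neg a\<close> requires that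
  \<open>f = h a\<close> be first decomposed into \<open>h|a\<close>, by a relation read from right to left.
\<close>

lemma equiv_absorb:
  assumes "carries C f ls g" "is_path C x (us @ Pos f # ls)"
  shows "equivclp (env_step C) (x, us @ Pos f # ls) (x, us @ [Pos g])"
  using assms
proof (induction ls arbitrary: f)
  case (Cons l ls)
  then have f: "f \<in> arr C" "lsrc C l = tgt C f" by (auto simp: is_path_append)
  show ?case
  proof (cases l)
    case (Pos a)
    have "env_step C (x, us @ [Pos f, Pos a] @ ls) (x, us @ [Pos (f \<cdot> a)] @ ls)"
      using Cons.prems Pos by (intro env_step.comp) simp
    note step = this and path = env_step_path(2)[OF this]
    have "equivclp (env_step C) (x, us @ Pos (f \<cdot> a) # ls) (x, us @ [Pos g])"
      using Cons.IH[of "f \<cdot> a"] Cons.prems path Pos by simp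
    then show ?thesis
      using r_into_equivclp[of "env_step C", OF step] Pos by (auto intro: equivclp_trans)
  next
    case (Neg a)
    then obtain h where h: "h \<in> arr C" "tgt C h = src C a" "f = h \<cdot> a" "carries C h ls g"
      using Cons.prems by auto
    have "is_path C x (us @ [Pos h, Pos a] @ Neg a # ls)"
      using Cons.prems Neg h src_comp[of h a] by (auto simp: is_path_append tgt_obj)
    from env_step.comp[OF this]
    have s1: "env_step C (x, us @ [Pos h, Pos a] @ Neg a # ls) (x, us @ Pos f # l # ls)"
      using Neg h by simp
    have "is_path C x ((us @ [Pos h]) @ [Pos a, Neg a] @ ls)"
      using env_step_path(1)[OF s1] by simp
    from env_step.pos_neg[OF this]
    have s2: "env_step C (x, us @ [Pos h, Pos a] @ Neg a # ls) (x, us @ Pos h # ls)" by simp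
    have "equivclp (env_step C) (x, us @ Pos h # ls) (x, us @ [Pos g])"
      using Cons.IH[OF h(4)] env_step_path(2)[OF s2] by simp
    from equivclp_trans[OF r_into_equivclp[of "env_step C", OF s2] this] show ?thesis
      by (rule equivclp_trans[OF converse_r_into_equivclp[of "env_step C", OF s1]])
  qed
qed simp

text \<open>Insert \<open>f\<inverse>|f\<close> in front of the path, let \<open>f\<close> absorb the path, and cancel \<open>f\<inverse>|f\<close>.\<close>

lemma fixes_some_equiv_empty:
  assumes f: "f \<in> arr C" "tgt C f = x" and fix_f: "carries C f ls f" and path: "is_path C x ls"
  shows "equivclp (env_step C) (x, ls) (x, [])"
proof -
  have neg_pos: "is_path C x ([] @ [Neg f, Pos f] @ ms)" if "is_path C x ms" for ms
    using that f src_obj by simp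
  have "env_step C (x, [Neg f] @ Pos f # ls) (x, ls)"
    using env_step.neg_pos[OF neg_pos[OF path]] by simp
  moreover have "equivclp (env_step C) (x, [Neg f] @ Pos f # ls) (x, [Neg f] @ [Pos f])"
    using equiv_absorb[OF fix_f, of x "[Neg f]"] neg_pos[OF path] unfolding append.simps by blast
  moreover have "env_step C (x, [Neg f] @ [Pos f]) (x, [])"
    using env_step.neg_pos[OF neg_pos[of "[]"]] path is_path_obj by simp
  ultimately show ?thesis
    by (meson equivclp_sym equivclp_trans r_into_equivclp)
qed

lemma represents_identity_iff:
  assumes "is_path C x ls"
  shows "represents_identity C (x, ls) \<longleftrightarrow>
    ptgt C (x, ls) = x \<and> (\<exists>f\<in>arr C. tgt C f = x \<and> carries C f ls f)"
proof -
  have in_arr: "(y, ms) \<in> signed_paths C (arr C) \<longleftrightarrow> is_path C y ms" for y ms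
    unfolding signed_paths_def using is_path_arr[of C y ms] by auto
  have equiv: "equiv (signed_paths C (arr C)) (env_cong C)"
  proof (rule equivI)
    show "env_cong C \<subseteq> signed_paths C (arr C) \<times> signed_paths C (arr C)"
      unfolding env_cong_def by blast
    show "refl_on (signed_paths C (arr C)) (env_cong C)"
      unfolding env_cong_def refl_on_def by simp
    show "sym (env_cong C)"
      unfolding env_cong_def sym_def using equivclp_sym by fast
    show "trans (env_cong C)"
      unfolding env_cong_def trans_def using equivclp_trans by fast
  qed
  have "env_class C (x, ls) = env_class C (y, []) \<longleftrightarrow> equivclp (env_step C) (y, []) (x, ls)"
    if "y \<in> obj C" for y
  proof -
    have "(x, ls) \<in> signed_paths C (arr C)" "(y, []) \<in> signed_paths C (arr C)"
      using assms that in_arr by simp_all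
    then show ?thesis
      unfolding env_class_def using eq_equiv_class_iff[OF equiv, of "(x, ls)" "(y, [])"]
      by (simp add: env_cong_def) (metis equivclp_sym)
  qed
  then have "represents_identity C (x, ls) \<longleftrightarrow> (\<exists>y\<in>obj C. equivclp (env_step C) (y, []) (x, ls))"
    unfolding represents_identity_def Env_def by auto
  also have "\<dots> \<longleftrightarrow> ptgt C (x, ls) = x \<and> (\<exists>f\<in>arr C. tgt C f = x \<and> carries C f ls f)"
    (is "?L \<longleftrightarrow> ?R")
  proof
    assume ?L
    then obtain y where "y \<in> obj C" "equivclp (env_step C) (y, []) (x, ls)" by blast
    from equiv_empty_fixes_some[OF this(2,1)] show ?R by auto
  next
    assume ?R
    then have "equivclp (env_step C) (x, ls) (x, [])"
      using fixes_some_equiv_empty assms by blast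
    then show ?L using is_path_obj[OF assms] equivclp_sym by metis
  qed
  finally show ?thesis .
qed

section \<open>Negative-positive closed paths\<close>

lemma is_path_swap:
  assumes "is_path C x (neg_path u @ pos_path v)" "ptgt C (x, neg_path u @ pos_path v) = x"
    and "z = ptgt C (x, neg_path u)"
  shows "is_path C z (pos_path v @ neg_path u)" "ptgt C (z, pos_path v @ neg_path u) = z"
  using assms by (simp_all add: is_path_append)

text \<open>
  Both sides say that \<open>u\<close> and \<open>v\<close> have the same product. The products \<open>U\<close> and \<open>V\<close> are obtained as
  the images of the identity, and positive paths multiply any other arrow by them.
\<close>

lemma fixes_some_iff_swap_fixes_ident:
  assumes path: "is_path C x (neg_path u @ pos_path v)"
    and closed: "ptgt C (x, neg_path u @ pos_path v) = x"
    and z: "z = ptgt C (x, neg_path u)"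
  shows "(\<exists>f\<in>arr C. tgt C f = x \<and> carries C f (neg_path u @ pos_path v) f) \<longleftrightarrow>
    carries C (ident C z) (pos_path v @ neg_path u) (ident C z)"
proof -
  let ?i = "ident C z"
  have u: "is_path C z (pos_path u)" "ptgt C (z, pos_path u) = x"
    and v: "is_path C z (pos_path v)" "ptgt C (z, pos_path v) = x"
    using path closed z is_path_neg_path_iff[of x u z] by (simp_all add: is_path_append)
  have i: "?i \<in> arr C" "tgt C ?i = z" "src C ?i = z"
    using is_path_obj[OF u(1)] ident_arr tgt_ident src_ident by auto
  obtain U V where UV: "carries C ?i (pos_path u) U" "carries C ?i (pos_path v) V"
    using carries_pos_path_total by metis
  then have arr: "U \<in> arr C" "src C U = z" "tgt C U = x" "V \<in> arr C" "src C V = z" "tgt C V = x"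
    using carries_arr[OF UV(1)] carries_arr[OF UV(2)] i u v by auto
  have scaled: "carries C h (pos_path u) g \<longleftrightarrow> g = h \<cdot> U" "carries C h (pos_path v) g \<longleftrightarrow> g = h \<cdot> V"
    if "h \<in> arr C" "tgt C h = z" for h g
    using carries_scale[OF UV(1)] carries_scale[OF UV(2)] carries_unique that i u v comp_ident
    by metis+
  have neg: "carries C f (neg_path u) h \<longleftrightarrow> h \<in> arr C \<and> tgt C h = z \<and> f = h \<cdot> U"
    if "f \<in> arr C" "tgt C f = x" for f h
  proof
    assume c: "carries C f (neg_path u) h"
    have "h \<in> arr C" "tgt C h = z"
      using carries_arr[OF c that(1)] that path z by (simp_all add: is_path_append)
    then show "h \<in> arr C \<and> tgt C h = z \<and> f = h \<cdot> U"
      using c carries_neg_path_iff[of f h u] scaled that u by simp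
  next
    assume "h \<in> arr C \<and> tgt C h = z \<and> f = h \<cdot> U"
    then show "carries C f (neg_path u) h"
      using carries_neg_path_iff[of f h u] scaled that u by simp
  qed
  have "carries C ?i (pos_path v @ neg_path u) ?i \<longleftrightarrow> V = U"
    using neg[of V ?i] scaled(2)[of ?i] arr i ident_comp unfolding carries_append by metis
  moreover have "(\<exists>f\<in>arr C. tgt C f = x \<and> carries C f (neg_path u @ pos_path v) f) \<longleftrightarrow> V = U"
    (is "?E \<longleftrightarrow> _")
  proof
    assume ?E
    then obtain f h where "f \<in> arr C" "tgt C f = x" "carries C f (neg_path u) h"
      "carries C h (pos_path v) f"
      unfolding carries_append by blast
    then have "h \<in> arr C" "tgt C h = z" "h \<cdot> V = h \<cdot> U" using neg scaled by metis+
    then show "V = U" using left_cancel arr by metis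
  next
    assume "V = U"
    then have "carries C U (neg_path u) ?i" "carries C ?i (pos_path v) U"
      using neg[of U ?i] UV arr i ident_comp by metis+
    then show ?E using arr unfolding carries_append by blast
  qed
  ultimately show ?thesis by simp
qed

lemma pos_path_to_identity:
  assumes "carries C h (pos_path u) e" "e \<in> identities C" "h \<in> arr C" "is_path C (tgt C h) (pos_path u)"
  shows "h \<in> identities C \<and> set u \<subseteq> identities C"
  using assms
proof (induction u arbitrary: h)
  case (Cons a u)
  then have a: "a \<in> arr C" "tgt C h = src C a" by (auto simp: pos_path_def)
  have "h \<cdot> a \<in> identities C \<and> set u \<subseteq> identities C"
    using Cons.IH[of "h \<cdot> a"] Cons.prems a comp_arr[of h a] tgt_comp[of h a]
    by (simp add: pos_path_def)
  then show ?case using factor_of_identity[of h a] a Cons.prems by simp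
qed (simp add: pos_path_def)

text \<open>
  If \<open>u\<inverse>\<close> sends the identity to \<open>h\<close> and \<open>v\<close> sends \<open>h\<close> back to the identity, the products of \<open>h\<close>
  with \<open>u\<close> and with \<open>v\<close> are identities, and so are all their factors.
\<close>

lemma neg_pos_fixes_ident_iff:
  assumes path: "is_path C z (neg_path u @ pos_path v)"
    and erased: "erase C (neg_path u @ pos_path v) = neg_path u @ pos_path v"
  shows "carries C (ident C z) (neg_path u @ pos_path v) (ident C z) \<longleftrightarrow> u = [] \<and> v = []"
proof
  let ?i = "ident C z" and ?y = "ptgt C (z, neg_path u)"
  assume "carries C ?i (neg_path u @ pos_path v) ?i"
  then obtain h where h: "carries C ?i (neg_path u) h" "carries C h (pos_path v) ?i"
    unfolding carries_append by blast
  have z: "z \<in> obj C" using is_path_obj[OF path] .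
  then have i: "?i \<in> arr C" "tgt C ?i = z" "?i \<in> identities C"
    using ident_arr tgt_ident unfolding identities_def by auto
  have u: "is_path C ?y (pos_path u)" "ptgt C (?y, pos_path u) = z" "is_path C ?y (pos_path v)"
    using path is_path_neg_path_iff[of z u ?y] by (simp_all add: is_path_append)
  have ha: "h \<in> arr C" "tgt C h = ?y"
    using carries_arr[OF h(1)] i path by (simp_all add: is_path_append)
  then have "carries C h (pos_path u) ?i"
    using carries_neg_path_iff[of ?i h u] h u i by simp
  then have "set u \<subseteq> identities C" "set v \<subseteq> identities C"
    using pos_path_to_identity h ha i u by metis+
  moreover have "set u \<inter> identities C = {}" "set v \<inter> identities C = {}"
    using erased unfolding erase_def filter_id_conv
    by (simp_all add: neg_path_def pos_path_def ball_Un disjoint_iff)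
  ultimately have "set u = {}" "set v = {}" by (metis Int_absorb2)+
  then show "u = [] \<and> v = []" by simp
next
  assume "u = [] \<and> v = []"
  then show "carries C (ident C z) (neg_path u @ pos_path v) (ident C z)"
    by (simp add: neg_path_def pos_path_def)
qed

end

section \<open>Cost of the algorithm\<close>

fun positives :: "'m signed list \<Rightarrow> nat" where
  "positives [] = 0"
| "positives (Pos a # ls) = Suc (positives ls)"
| "positives (Neg a # ls) = positives ls"

fun negatives :: "'m signed list \<Rightarrow> nat" where
  "negatives [] = 0"
| "negatives (Pos a # ls) = negatives ls"
| "negatives (Neg a # ls) = Suc (negatives ls)"

fun inversions :: "'m signed list \<Rightarrow> nat" where
  "inversions [] = 0"
| "inversions (Pos a # ls) = negatives ls + inversions ls"
| "inversions (Neg a # ls) = inversions ls"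

lemma negatives_append: "negatives (us @ vs) = negatives us + negatives vs"
  by (induction us rule: negatives.induct) auto

lemma inversions_append:
  "inversions (us @ vs) = inversions us + inversions vs + positives us * negatives vs"
  by (induction us rule: inversions.induct) (auto simp: negatives_append)

lemma negatives_le_length: "negatives ls \<le> length ls"
  by (induction ls rule: negatives.induct) auto

lemma inversions_le: "inversions ls \<le> (length ls)\<^sup>2"
proof (induction ls rule: inversions.induct)
  case (2 a ls)
  then show ?case using negatives_le_length[of ls] by (simp add: power2_eq_square)
qed (simp_all add: power2_eq_square)

lemma left_rev_decreases:
  assumes "left_rev C p q"
  shows "inversions (snd q) < inversions (snd p)" "plength q \<le> plength p"
proof -
  obtain us a b vs m where p: "snd p = us @ [Pos b, Neg a] @ vs" and q: "snd q = us @ m @ vs"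
    and m: "m = [] \<or> m = erase C [Neg (lcm_selector C a b), Pos (lcm_selector C b a)]"
    using assms by (cases rule: left_rev.cases) (auto split: if_splits)
  have m': "inversions m = 0" "positives m \<le> 1" "negatives m \<le> 1" "length m \<le> 2"
    using m by (auto simp: erase_def)
  then show "plength q \<le> plength p" using p q by simp
  have "positives us * negatives m \<le> positives us" "positives m * negatives vs \<le> negatives vs"
    using mult_le_mono2[OF m'(3), of "positives us"] mult_le_mono1[OF m'(2), of "negatives vs"]
    by simp_all
  moreover have "inversions (snd q) = inversions us + inversions vs + positives us * negatives vs +
    positives us * negatives m + positives m * negatives vs"
    using m'(1) unfolding q by (simp add: inversions_append negatives_append algebra_simps)
  moreover have "inversions (snd p) = inversions us + inversions vs + positives us * negatives vs +
    positives us + negatives vs + 1"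
    unfolding p by (simp add: inversions_append negatives_append algebra_simps)
  ultimately show "inversions (snd q) < inversions (snd p)" by linarith
qed

text \<open>
  An upper bound for the cost of what remains to be done: the inversions bound the number of
  replacements of the current reversing, the square of the length those of a reversing to come, and
  the remaining terms are the passes through the path.
\<close>

fun potential :: "('o, 'm) state \<Rightarrow> nat" where
  "potential (Start w) = 2 * (plength w)\<^sup>2 + 3 * plength w + 3"
| "potential (Rev1 p) = inversions (snd p) + (plength p)\<^sup>2 + 2 * plength p + 2"
| "potential (Rev2 p) = inversions (snd p) + plength p + 1"
| "potential (Return b) = 0"

lemma alg_step_cost:
  assumes "alg_step C s n t"
  shows "0 < n" "n + potential t \<le> potential s"
proof -
  show "0 < n" using assms by cases auto
  show "n + potential t \<le> potential s"
    using assms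
  proof cases
    case (start w)
    have l: "length (erase C (snd w)) \<le> plength w" by (simp add: erase_def)
    then have "(length (erase C (snd w)))\<^sup>2 \<le> (plength w)\<^sup>2" by (rule power_mono) simp
    then show ?thesis
      unfolding start(1-3) potential.simps snd_conv
      using l inversions_le[of "erase C (snd w)"] by linarith
  next
    case (rev1 p q)
    have "(plength q)\<^sup>2 \<le> (plength p)\<^sup>2"
      using left_rev_decreases(2)[OF rev1(4)] by (rule power_mono) simp
    then show ?thesis
      unfolding rev1(1-3) potential.simps using left_rev_decreases[OF rev1(4)] by linarith
  next
    case (rev2 p q)
    then show ?thesis using left_rev_decreases[OF rev2(4)] by simp
  next
    case (swap x u v)
    have "inversions (pos_path v @ neg_path u) \<le> (length u + length v)\<^sup>2"
      using inversions_le[of "pos_path v @ neg_path u"]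
      by (simp add: pos_path_def neg_path_def add.commute)
    then show ?thesis using swap by (simp add: pos_path_def neg_path_def)
  qed (simp_all add: pos_path_def neg_path_def)
qed

lemma alg_run_cost:
  assumes "alg_run C s n t"
  shows "n + potential t \<le> potential s"
  using assms
proof induction
  case (step s m t n t')
  then show ?case using alg_step_cost(2)[OF step(2)] by simp
qed simp

lemma alg_terminates: "\<not> (\<exists>s. s 0 = Start w \<and> (\<forall>i. \<exists>n. alg_step C (s i) n (s (Suc i))))"
proof
  assume "\<exists>s. s 0 = Start w \<and> (\<forall>i. \<exists>n. alg_step C (s i) n (s (Suc i)))"
  then obtain s n where s: "alg_step C (s i) (n i) (s (Suc i))" for i by metis
  have step: "potential (s (Suc i)) < potential (s i)" for i
    using alg_step_cost[OF s[of i]] by simp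
  have "potential (s i) + i \<le> potential (s 0)" for i
  proof (induction i)
    case (Suc i)
    then show ?case using step[of i] by simp
  qed simp
  from this[of "Suc (potential (s 0))"] show False by simp
qed

section \<open>Correctness of the algorithm\<close>

lemma reducible_or_neg_pos:
  obtains us b a vs where "ls = us @ [Pos b, Neg a] @ vs"
  | u v where "ls = neg_path u @ pos_path v"
proof -
  have "(\<exists>us b a vs. ls = us @ [Pos b, Neg a] @ vs) \<or> (\<exists>u v. ls = neg_path u @ pos_path v)"
  proof (induction ls)
    case Nil
    have "[] = neg_path [] @ pos_path []" by (simp add: neg_path_def pos_path_def)
    then show ?case by blast
  next
    case (Cons l ls)
    then show ?case
    proof
      assume "\<exists>us b a vs. ls = us @ [Pos b, Neg a] @ vs"
      then show ?thesis by (metis append_Cons)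
    next
      assume "\<exists>u v. ls = neg_path u @ pos_path v"
      then obtain u v where ls: "ls = neg_path u @ pos_path v" by blast
      show ?thesis
      proof (cases l)
        case (Neg a)
        then have "l # ls = neg_path (u @ [a]) @ pos_path v" using ls by (simp add: neg_path_def)
        then show ?thesis by blast
      next
        case (Pos b)
        show ?thesis
        proof (cases u rule: rev_cases)
          case Nil
          then have "l # ls = neg_path [] @ pos_path (b # v)"
            using ls Pos by (simp add: neg_path_def pos_path_def)
          then show ?thesis by blast
        next
          case (snoc u' a)
          then have "l # ls = [] @ [Pos b, Neg a] @ neg_path u' @ pos_path v"
            using ls Pos by (simp add: neg_path_def)
          then show ?thesis by blast
        qed
      qed
    qed
  qed
  then show ?thesis using that by blast
qed

lemma alg_stops_only_at_Return:
  assumes "\<not> (\<exists>n t'. alg_step C t n t')"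
  obtains b where "t = Return b"
proof (cases t)
  case (Start w)
  then show ?thesis using assms alg_step.reject[of w C] alg_step.start[of w C] by metis
next
  case (Rev1 p)
  obtain x ls where p: "p = (x, ls)" by (cases p)
  show ?thesis
    using reducible_or_neg_pos[of ls] assms Rev1 p alg_step.rev1[OF left_rev.intros] alg_step.swap
    by metis
next
  case (Rev2 p)
  obtain x ls where p: "p = (x, ls)" by (cases p)
  show ?thesis
    using reducible_or_neg_pos[of ls] assms Rev2 p alg_step.rev2[OF left_rev.intros] alg_step.answer
    by metis
qed (use that in blast)

text \<open>
  The invariant of the algorithm on input \<open>w\<close>: the question that each state has still to decide has
  the same answer as the original one. The first reversing asks whether a closed path fixes some
  arrow, the second one whether it fixes the identity. The entries that are identities must have
  been removed for the last test to be conclusive.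
\<close>

fun faithful :: "('o, 'm) cat \<Rightarrow> ('o, 'm) spath \<Rightarrow> ('o, 'm) state \<Rightarrow> bool" where
  "faithful C w (Start p) \<longleftrightarrow> p = w"
| "faithful C w (Rev1 (x, ls)) \<longleftrightarrow> is_path C x ls \<and> ptgt C (x, ls) = x \<and> erase C ls = ls \<and>
     (represents_identity C w \<longleftrightarrow> (\<exists>f\<in>arr C. tgt C f = x \<and> carries C f ls f))"
| "faithful C w (Rev2 (z, ls)) \<longleftrightarrow> is_path C z ls \<and> ptgt C (z, ls) = z \<and> erase C ls = ls \<and>
     (represents_identity C w \<longleftrightarrow> carries C (ident C z) ls (ident C z))"
| "faithful C w (Return b) \<longleftrightarrow> b = represents_identity C w"

context lcm_category
begin

lemma alg_step_faithful:
  assumes "alg_step C s n t" "faithful C w s" "w \<in> signed_paths C (arr C)"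
  shows "faithful C w t"
proof -
  obtain x ls where w: "w = (x, ls)" by (cases w)
  then have path: "is_path C x ls" using assms(3) by (simp add: signed_paths_def)
  note w_iff = represents_identity_iff[OF path]
  show ?thesis
    using assms(1)
  proof cases
    case (reject w')
    then show ?thesis using assms(2) w w_iff by auto
  next
    case (start w')
    then have "ptgt C (x, ls) = x" using assms(2) w by simp
    moreover have "erase C (erase C ls) = erase C ls" by (simp add: erase_def)
    ultimately show ?thesis
      using start assms(2) w w_iff is_path_erase[OF path] carries_erase path by auto
  next
    case (rev1 p q)
    obtain y ms y' ms' where pq: "p = (y, ms)" "q = (y', ms')" by (cases p, cases q)
    then show ?thesis
      using rev1 assms(2) left_rev_step[of y ms y' ms'] by auto
  next
    case (rev2 p q)
    obtain z ms z' ms' where pq: "p = (z, ms)" "q = (z', ms')" by (cases p, cases q)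
    then have "ident C z \<in> arr C" "tgt C (ident C z) = z"
      using assms(2) rev2 is_path_obj[of z ms] ident_arr tgt_ident by auto
    then show ?thesis
      using pq rev2 assms(2) left_rev_step[of z ms z' ms'] by auto
  next
    case (swap y u v)
    have "erase C (neg_path u @ pos_path v) = neg_path u @ pos_path v"
      using assms(2) swap by simp
    then have "erase C (pos_path v @ neg_path u) = pos_path v @ neg_path u"
      unfolding erase_def filter_id_conv set_append by blast
    then show ?thesis
      using swap assms(2) is_path_swap[of y u v, OF _ _ HOL.refl]
        fixes_some_iff_swap_fixes_ident[of y u v, OF _ _ HOL.refl] by simp
  next
    case (answer z u v)
    then show ?thesis using assms(2) neg_pos_fixes_ident_iff[of z u v] by simp
  qed
qed

lemma alg_returns_represents_identity:
  assumes "w \<in> signed_paths C (arr C)"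
  shows "alg_returns C w (represents_identity C w)"
proof -
  have faithful_run: "faithful C w t" if "alg_run C s m t" "faithful C w s" for s m t
    using that by induction (auto intro: alg_step_faithful assms)
  show ?thesis
    unfolding alg_returns_def
  proof (intro conjI allI impI)
    fix m t assume "alg_run C (Start w) m t \<and> \<not> (\<exists>n t'. alg_step C t n t')"
    then have "faithful C w t" and "\<exists>b. t = Return b"
      using faithful_run[of "Start w" m t] alg_stops_only_at_Return[of C t] by auto
    then show "t = Return (represents_identity C w)" by auto
  qed (rule alg_terminates)
qed

end

theorem proposition5p28:
  fixes C :: "('o, 'm) cat" and S :: "'m set"
  assumes "ore_category C"
    and "admits_unique_left_lcms C"
    and "strong_garside_family C S"
  shows "(\<forall>w\<in>signed_paths C S. alg_returns C w (represents_identity C w)) \<and>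
    (finite S \<longrightarrow>
      (\<exists>c. \<forall>w\<in>signed_paths C S. \<forall>n t. alg_run C (Start w) n t \<longrightarrow> n \<le> c * ((plength w)\<^sup>2 + 1)))"
proof -
  interpret lcm_category C
    using assms(1,2) unfolding ore_category_def lcm_category_def lcm_category_axioms_def by blast
  have "S \<subseteq> arr C"
    using assms(3) unfolding strong_garside_family_def garside_family_def by blast
  then have "signed_paths C S \<subseteq> signed_paths C (arr C)" unfolding signed_paths_def by blast
  moreover have "n \<le> 5 * ((plength w)\<^sup>2 + 1)" if "alg_run C (Start w) n t" for w n t
  proof -
    have "plength w \<le> (plength w)\<^sup>2" unfolding power2_eq_square by (rule le_square)
    then show ?thesis using alg_run_cost[OF that] by simp
  qed
  ultimately show ?thesis using alg_returns_represents_identity by blast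
qed

end
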